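(* Let $a, b$ be relatively prime positive integers such that $\frac{3}{2} < \frac{a}{b} < \frac{5}{3}$ and $\gcd(b, 5) = 1$. Let $\varphi$ be the $(5a-4b)$-uniform morphism on $\mathbb{Z}_{\geq 0}$ defined by $\varphi(n) = 0^{a-1} \, 1 \, 0^{a-b-1} \, 1 \, 0^{2 a-2 b-1} \, 1 \, 0^{a-b-1} \, (n+1)$. Then $\textbf{w}_{a/b} = \varphi^\infty(0)$. In particular, $\rho(\frac{a}{b}) = 5a-4b$.
   Context: Words are indexed from position $0$; a factor is a contiguous subword; $c^m$ denotes $m$ copies of the letter $c$. For relatively prime positive integers $a,b$ and a nonempty word $v$ whose length is divisible by $b$, define $v^{a/b} = v^{\lfloor a/b \rfloor} v_0 v_1 \cdots v_{t-1}$, where $t = |v|\,(a/b - \lfloor a/b\rfloor)$; such a word is called an $\frac{a}{b}$-power. A word is $\frac{a}{b}$-power-free if none of its factors is an $\frac{a}{b}$-power. For $\frac{a}{b} > 1$, $\textbf{w}_{a/b}$ denotes the lexicographically least infinite word over $\mathbb{Z}_{\geq 0}$ that is $\frac{a}{b}$-power-free. A morphism $\varphi$ on $\Sigma$ is a map $\Sigma \to \Sigma^*$ extended by concatenation; it is $k$-uniform if all images have length $k$; if $\varphi(c)$ begins with $c$, $\varphi^\infty(c)$ is the infinite fixed point beginning with $c$. For $k \geq 2$, an integer sequence $s(i)_{i\ge0}$ is $k$-regular if the $\mathbb{Z}$-module generated by $\{ s(k^e i + j)_{i \geq 0} : e \geq 0,\ 0 \leq j \leq k^e - 1 \}$ is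 finitely generated. Integers $k,l\ge 2$ are multiplicatively dependent ($k\sim l$) if $k^s=l^t$ for some positive integers $s,t$. When nonempty, the set of $k\ge2$ for which the letter sequence of $\textbf{w}_{a/b}$ is $k$-regular is a single $\sim$-class, denoted $\rho(\frac{a}{b})$; writing $\rho(\frac{a}{b}) = k$ means $k$ belongs to this class. *)

theory Defs
  imports Complex_Main
    "HOL-Library.Omega_Words_Fun"
    "HOL-Library.Fun_Lexorder"
    "HOL-Library.Function_Algebras"
begin

text \<open>Finite words are lists; infinite words are functions on \<^typ>\<open>nat\<close>
  (\<^theory>\<open>HOL-Library.Omega_Words_Fun\<close>), so \<open>w [i \<rightarrow> j]\<close> is the factor of \<open>w\<close> at the
  positions \<open>i, \<dots>, j - 1\<close>.\<close>

subsection \<open>Fractional powers\<close>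

text \<open>The length of the final partial copy is \<open>|v| (a/b - \<lfloor>a/b\<rfloor>) = |v| (a mod b) / b\<close>, an exact
  quotient when \<open>b\<close> divides \<open>|v|\<close>.\<close>

definition frac_power :: "nat \<Rightarrow> nat \<Rightarrow> 'a list \<Rightarrow> 'a list" where
  "frac_power a b v =
     concat (replicate (a div b) v) @ take (length v * (a mod b) div b) v"

definition is_frac_power :: "nat \<Rightarrow> nat \<Rightarrow> 'a list \<Rightarrow> bool" where
  "is_frac_power a b u \<longleftrightarrow> (\<exists>v. v \<noteq> [] \<and> b dvd length v \<and> u = frac_power a b v)"

definition frac_power_free :: "nat \<Rightarrow> nat \<Rightarrow> 'a word \<Rightarrow> bool" where
  "frac_power_free a b w \<longleftrightarrow> (\<forall>i j. \<not> is_frac_power a b (w [i \<rightarrow> j]))"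

definition lex_least_frac_power_free :: "nat \<Rightarrow> nat \<Rightarrow> nat word \<Rightarrow> bool" where
  "lex_least_frac_power_free a b w \<longleftrightarrow>
     frac_power_free a b w \<and>
     (\<forall>w'. frac_power_free a b w' \<longrightarrow> w' = w \<or> less_fun w w')"

text \<open>Meaningful for \<open>a/b > 1\<close>; see \<open>ex1_lex_least_frac_power_free\<close> below.\<close>

definition least_word :: "nat \<Rightarrow> nat \<Rightarrow> nat word" where
  "least_word a b = (THE w. lex_least_frac_power_free a b w)"

subsection \<open>Morphisms\<close>

definition morph :: "('a \<Rightarrow> 'b list) \<Rightarrow> 'a list \<Rightarrow> 'b list" where
  "morph \<phi> u = concat (map \<phi> u)"

definition uniform_morphism :: "nat \<Rightarrow> ('a \<Rightarrow> 'b list) \<Rightarrow> bool" where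
  "uniform_morphism k \<phi> \<longleftrightarrow> (\<forall>c. length (\<phi> c) = k)"

text \<open>\<open>w'\<close> is the image of the infinite word \<open>w\<close>: it is infinite and extends the images of all
  prefixes of \<open>w\<close>.\<close>

definition morph_image :: "('a \<Rightarrow> 'b list) \<Rightarrow> 'a word \<Rightarrow> 'b word \<Rightarrow> bool" where
  "morph_image \<phi> w w' \<longleftrightarrow>
     (\<forall>n. prefix (length (morph \<phi> (prefix n w))) w' = morph \<phi> (prefix n w)) \<and>
     (\<forall>m. \<exists>n. m \<le> length (morph \<phi> (prefix n w)))"

text \<open>The infinite fixed point beginning with \<open>c\<close>; see \<open>ex1_fixed_point\<close> below.\<close>

definition morph_limit :: "('a \<Rightarrow> 'a list) \<Rightarrow> 'a \<Rightarrow> 'a word" where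
  "morph_limit \<phi> c = (THE w. w 0 = c \<and> morph_image \<phi> w w)"

definition phi :: "nat \<Rightarrow> nat \<Rightarrow> nat \<Rightarrow> nat list" where
  "phi a b n =
     replicate (a - 1) 0 @ [1] @ replicate (a - b - 1) 0 @ [1] @
     replicate (2 * a - 2 * b - 1) 0 @ [1] @ replicate (a - b - 1) 0 @ [n + 1]"

subsection \<open>Regular sequences\<close>

global_interpretation int_seq: module "\<lambda>(c::int) (s::nat \<Rightarrow> int) i. c * s i"
  defines int_seq_span = int_seq.span
  by unfold_locales (auto simp: fun_eq_iff algebra_simps)

definition kernel :: "nat \<Rightarrow> (nat \<Rightarrow> int) \<Rightarrow> (nat \<Rightarrow> int) set" where
  "kernel k s = {(\<lambda>i. s (k ^ e * i + j)) | e j. j \<le> k ^ e - 1}"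

definition regular_sequence :: "nat \<Rightarrow> (nat \<Rightarrow> int) \<Rightarrow> bool" where
  "regular_sequence k s \<longleftrightarrow> (\<exists>G. finite G \<and> int_seq_span G = int_seq_span (kernel k s))"

text \<open>When nonempty, this set is a single class of the multiplicative dependence relation, and
  \<open>\<rho>(a/b) = k\<close> means that \<open>k\<close> belongs to it.\<close>

definition rho :: "nat \<Rightarrow> nat \<Rightarrow> nat set" where
  "rho a b = {k. k \<ge> 2 \<and> regular_sequence k (\<lambda>i. int (least_word a b i))}"

subsection \<open>The two definite descriptions are well defined\<close>

definition frac_power_free_list :: "nat \<Rightarrow> nat \<Rightarrow> 'a list \<Rightarrow> bool" where
  "frac_power_free_list a b u \<longleftrightarrow> (\<forall>x f y. u = x @ f @ y \<longrightarrow> \<not> is_frac_power a b f)"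

lemma frac_power_free_iff_prefix:
  "frac_power_free a b w \<longleftrightarrow> (\<forall>n. frac_power_free_list a b (prefix n w))"
proof (intro iffI allI)
  fix n assume *: "frac_power_free a b w"
  show "frac_power_free_list a b (prefix n w)"
    unfolding frac_power_free_list_def
  proof (intro allI impI)
    fix x f y assume eq: "prefix n w = x @ f @ y"
    then have len: "length x + length f \<le> n"
      by (metis add.assoc diff_zero le_add1 length_append length_map length_upt subsequence_def)
    have "f = take (length f) (drop (length x) (prefix n w))"
      using eq by simp
    also have "\<dots> = (w [length x \<rightarrow> length x + length f])"
      using len by (auto simp: subsequence_def take_map drop_map min_def)
    finally show "\<not> is_frac_power a b f"
      using * unfolding frac_power_free_def by metis
  qed
next
  assume *: "\<forall>n. frac_power_free_list a b (prefix n w)"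
  show "frac_power_free a b w"
    unfolding frac_power_free_def
  proof (intro allI)
    fix i j
    show "\<not> is_frac_power a b (w [i \<rightarrow> j])"
    proof (cases "i \<le> j")
      case True
      then have "prefix j w = prefix i w @ (w [i \<rightarrow> j]) @ []"
        using subsequence_append[of w i "j - i"] by simp
      then show ?thesis using * unfolding frac_power_free_list_def by blast
    next
      case False
      then have "prefix 0 w = [] @ (w [i \<rightarrow> j]) @ []"
        by (simp add: subsequence_def)
      then show ?thesis using * unfolding frac_power_free_list_def by blast
    qed
  qed
qed

lemma frac_power_free_list_prefix:
  "frac_power_free_list a b (u @ v) \<Longrightarrow> frac_power_free_list a b u"
  unfolding frac_power_free_list_def by (metis append.assoc)

lemma frac_power_free_list_fresh:
  assumes "0 < b" "b < a" "frac_power_free_list a b u" "c \<notin> set u"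
  shows "frac_power_free_list a b (u @ [c])"
  unfolding frac_power_free_list_def
proof (intro allI impI notI)
  fix x f y assume eq: "u @ [c] = x @ f @ y" and pow: "is_frac_power a b f"
  from pow obtain v where v: "v \<noteq> []" "b dvd length v" "f = frac_power a b v"
    unfolding is_frac_power_def by blast
  define r where
    "r = concat (replicate (a div b - 1) v) @ take (length v * (a mod b) div b) v"
  have ab: "a div b \<ge> 1" using assms by (simp add: Suc_leI div_greater_zero_iff)
  then have f: "f = v @ r"
    unfolding v(3) frac_power_def r_def
    by (metis append.assoc concat.simps(2) le_add_diff_inverse plus_1_eq_Suc replicate_Suc)
  have r: "r \<noteq> []"
  proof (cases "a div b = 1")
    case True
    obtain q where q: "length v = b * q" using v(2) by auto
    with v(1) have "q > 0" by (cases q) auto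
    moreover have "a mod b > 0"
      using True assms by (metis div_mult_mod_eq mult_1 add_0_right less_irrefl not_gr0)
    ultimately show ?thesis using v(1) q assms(1) unfolding r_def by simp
  next
    case False
    then have "a div b - 1 \<noteq> 0" using ab by simp
    then show ?thesis using v(1) unfolding r_def by (cases "a div b - 1") auto
  qed
  have sub: "set r \<subseteq> set v"
    unfolding r_def by (auto dest: in_set_takeD)
  show False
  proof (cases "y = []")
    case True
    then have "u @ [c] = (x @ v @ butlast r) @ [last r]"
      using eq f r by simp
    then have "u = x @ v @ butlast r" "c = last r"
      by (simp_all only: append1_eq_conv)
    then show False
      using assms(4) subsetD[OF sub last_in_set[OF r]] by simp
  next
    case False
    then have "u = x @ f @ butlast y"
      using eq by (metis append_butlast_last_id append.assoc butlast_snoc)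
    then show False
      using assms(3) pow unfolding frac_power_free_list_def by blast
  qed
qed

lemma ex1_lex_least_frac_power_free:
  assumes "0 < b" "b < a"
  shows "\<exists>!w. lex_least_frac_power_free a b w"
proof -
  let ?P = "\<lambda>u :: nat list. frac_power_free_list a b u"
  define next_letter where "next_letter u = (LEAST c. ?P (u @ [c]))" for u
  define g where "g = rec_nat [] (\<lambda>_ u. u @ [next_letter u])"
  have g0: "g 0 = []" and gS: "\<And>n. g (Suc n) = g n @ [next_letter (g n)]"
    unfolding g_def by simp_all
  define w where "w n = next_letter (g n)" for n
  have g: "g n = prefix n w" for n
    by (induction n) (simp_all add: g0 gS w_def subsequence_def)
  have Pg: "?P (g n)" for n
  proof (induction n)
    case 0
    have "\<not> is_frac_power a b ([] :: nat list)"
    proof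
      assume "is_frac_power a b ([] :: nat list)"
      then obtain v :: "nat list" where "v \<noteq> []" "frac_power a b v = []"
        unfolding is_frac_power_def by metis
      moreover have "a div b > 0" using assms by (simp add: div_greater_zero_iff)
      ultimately show False by (auto simp: frac_power_def)
    qed
    then show ?case by (simp add: g0 frac_power_free_list_def)
  next
    case (Suc n)
    obtain c where "c \<notin> set (g n)" using ex_new_if_finite[OF infinite_UNIV_nat] by blast
    then have "?P (g n @ [c])" by (rule frac_power_free_list_fresh[OF assms Suc])
    then show ?case unfolding gS next_letter_def by (rule LeastI)
  qed
  have "less_fun w w'" if "frac_power_free a b w'" "w' \<noteq> w" for w'
  proof -
    define k where "k = (LEAST k. w k \<noteq> w' k)"
    from that(2) have "\<exists>k. w k \<noteq> w' k" by auto
    then have k: "w k \<noteq> w' k" unfolding k_def by (rule LeastI_ex)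
    have below: "\<forall>k'<k. w k' = w' k'" unfolding k_def using not_less_Least by blast
    then have "prefix k w = prefix k w'" by (simp add: subsequence_def)
    then have "prefix (Suc k) w' = g k @ [w' k]" by (simp add: g subsequence_def)
    then have "?P (g k @ [w' k])" using that(1) by (metis frac_power_free_iff_prefix)
    then have "w k \<le> w' k" unfolding w_def next_letter_def by (rule Least_le)
    with k below show ?thesis unfolding less_fun_def by (meson order_le_imp_less_or_eq)
  qed
  moreover have "frac_power_free a b w"
    using Pg by (simp add: frac_power_free_iff_prefix g)
  ultimately have "lex_least_frac_power_free a b w"
    unfolding lex_least_frac_power_free_def by blast
  then show ?thesis
    unfolding lex_least_frac_power_free_def by (metis less_fun_asym)
qed

lemma morph_image_uniform_iff:
  assumes "uniform_morphism k \<phi>" "k > 0"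
  shows "morph_image \<phi> w w' \<longleftrightarrow> (\<forall>i. (w' [k * i \<rightarrow> k * i + k]) = \<phi> (w i))"
proof -
  have len: "length (morph \<phi> (prefix n w)) = k * n" for n
    using assms(1)
    by (induction n) (simp_all add: morph_def subsequence_def uniform_morphism_def)
  have step: "morph \<phi> (prefix (Suc n) w) = morph \<phi> (prefix n w) @ \<phi> (w n)"
    "prefix (k * Suc n) w' = prefix (k * n) w' @ (w' [k * n \<rightarrow> k * n + k])" for n
    using subsequence_append[of w' "k * n" k]
    by (simp_all add: morph_def subsequence_def add.commute)
  have "(\<forall>n. prefix (k * n) w' = morph \<phi> (prefix n w)) \<longleftrightarrow>
        (\<forall>i. (w' [k * i \<rightarrow> k * i + k]) = \<phi> (w i))"
  proof (intro iffI allI)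
    fix i assume *: "\<forall>n. prefix (k * n) w' = morph \<phi> (prefix n w)"
    from *[rule_format, of "Suc i"] *[rule_format, of i]
    show "(w' [k * i \<rightarrow> k * i + k]) = \<phi> (w i)" by (simp only: step same_append_eq)
  next
    fix n assume *: "\<forall>i. (w' [k * i \<rightarrow> k * i + k]) = \<phi> (w i)"
    show "prefix (k * n) w' = morph \<phi> (prefix n w)"
    proof (induction n)
      case 0
      show ?case by (simp add: morph_def subsequence_def)
    next
      case (Suc n)
      show ?case unfolding step Suc *[rule_format] ..
    qed
  qed
  moreover have "\<exists>n. m \<le> k * n" for m
    using assms(2) by (intro exI[of _ m]) (cases k; simp)
  ultimately show ?thesis unfolding morph_image_def len by simp
qed

lemma ex1_fixed_point:
  assumes "uniform_morphism k \<phi>" "k \<ge> 2" "hd (\<phi> c) = c"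
  shows "\<exists>!w. w 0 = c \<and> morph_image \<phi> w w"
proof -
  have len: "length (\<phi> x) = k" for x
    using assms(1) by (simp add: uniform_morphism_def)
  have iff: "morph_image \<phi> w w \<longleftrightarrow> (\<forall>n. w n = \<phi> (w (n div k)) ! (n mod k))" for w
  proof -
    have "morph_image \<phi> w w \<longleftrightarrow> (\<forall>i. \<forall>j<k. w (k * i + j) = \<phi> (w i) ! j)"
      using morph_image_uniform_iff[OF assms(1), of w w] assms(2)
      by (simp add: list_eq_iff_nth_eq len subsequence_def)
    also have "\<dots> \<longleftrightarrow> (\<forall>n. w n = \<phi> (w (n div k)) ! (n mod k))"
    proof (intro iffI allI impI)
      fix n assume "\<forall>i. \<forall>j<k. w (k * i + j) = \<phi> (w i) ! j"
      then have "w (k * (n div k) + n mod k) = \<phi> (w (n div k)) ! (n mod k)"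
        using mod_less_divisor[of k n] assms(2)
        by (metis pos2 order_less_le_trans)
      then show "w n = \<phi> (w (n div k)) ! (n mod k)" by simp
    next
      fix i j assume "\<forall>n. w n = \<phi> (w (n div k)) ! (n mod k)" "j < k"
      from this(1)[rule_format, of "k * i + j"] this(2)
      show "w (k * i + j) = \<phi> (w i) ! j" by simp
    qed
    finally show ?thesis .
  qed
  define F where "F f n = (if n = 0 then c else \<phi> (f (n div k)) ! (n mod k))" for f n
  define w where "w = wfrec less_than F"
  have adm: "adm_wf less_than F"
    unfolding adm_wf_def F_def using assms(2) by auto
  have w: "w n = F w n" for n
    unfolding w_def using wfrec_fixpoint[OF wf_less_than adm] by metis
  have "\<phi> c ! 0 = c"
    using assms len[of c] by (cases "\<phi> c") auto
  then have "w 0 = c \<and> morph_image \<phi> w w"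
    unfolding iff using w by (metis F_def div_0 mod_0)
  moreover have "u = v"
    if u: "u 0 = c \<and> morph_image \<phi> u u" and v: "v 0 = c \<and> morph_image \<phi> v v" for u v
  proof
    fix n show "u n = v n"
    proof (induction n rule: less_induct)
      case (less n)
      show ?case
      proof (cases "n = 0")
        case False
        then have "u (n div k) = v (n div k)" using less assms(2) by simp
        then show ?thesis using u v unfolding iff by metis
      qed (use u v in simp)
    qed
  qed
  ultimately show ?thesis by blast
qed

lemma uniform_phi:
  assumes "b < a"
  shows "uniform_morphism (5 * a - 4 * b) (phi a b)"
  using assms by (auto simp: uniform_morphism_def phi_def)

lemma hd_phi:
  assumes "1 < a"
  shows "hd (phi a b n) = 0"
  using assms by (cases "a - 1") (auto simp: phi_def)

end

theory Submission
  imports Defs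
begin

text \<open>Put \<open>c = a - b\<close> and \<open>k = 5 a - 4 b = 5 c + b\<close>. Counted from position \<open>1\<close>, the fixed point
  \<open>W\<close> satisfies \<open>W (k t) = W t + 1\<close>, is \<open>1\<close> at the residues \<open>-c, -3 c, -4 c\<close> modulo \<open>k\<close>, and \<open>0\<close>
  at all others. An \<open>a/b\<close>-power is a window of length \<open>c m\<close> on which \<open>W\<close> agrees with its shift by
  \<open>b m\<close>. If \<open>k\<close> divides \<open>m\<close>, such a window contracts to one for \<open>m div k\<close>. Otherwise, since
  \<open>b \<equiv> -5 c\<close> and \<open>c\<close> is a unit modulo \<open>k\<close>, two nonzero letters at distance \<open>b m\<close> force \<open>5 m\<close> to be
  congruent to a number of absolute value at most \<open>4\<close>. For small \<open>m\<close> this is impossible, while every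
  window meets a nonzero letter of \<open>W\<close> or of its shift; for large \<open>m\<close> the window contains a full
  period of the set of nonzero positions; the four triples \<open>(b, c, m)\<close> in between are checked
  directly.
  Conversely, lowering a nonzero letter to \<open>0\<close> completes a power with \<open>m \<in> {1, 2}\<close>, and lowering
  \<open>W (k t)\<close> to \<open>u + 1\<close> completes the \<open>k\<close>-fold dilation of the power completed by lowering \<open>W t\<close>
  to \<open>u\<close>.\<close>

section \<open>Powers as repetitions at distance \<open>b * m\<close>\<close>

text \<open>As 1 < a/b < 2, a power is a word \<open>v\<close> followed by one of its own prefixes.
  Only the start \<open>i\<close> and the \<open>m\<close> with \<open>length v = b * m\<close>
  remain to be quantified.\<close>

lemma frac_power_free_iff_no_repetition:
  fixes w :: "'a word"
  assumes "0 < b" "b < a" "a < 2 * b"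
  shows "frac_power_free a b w \<longleftrightarrow>
    (\<forall>i m. 0 < m \<longrightarrow> (\<exists>x < (a - b) * m. w (i + x) \<noteq> w (i + b * m + x)))"
proof -
  have "a div b = 1"
    using assms by (intro div_nat_eqI) auto
  have "a mod b = a - b"
    using assms by (simp add: le_mod_geq)
  have power: "frac_power a b v = v @ take ((a - b) * m) v"
    if "length v = b * m" for v :: "'a list" and m
  proof -
    have "b * m * (a - b) div b = (a - b) * m"
      using assms(1) by (metis mult.assoc mult.commute nonzero_mult_div_cancel_left less_irrefl)
    with that \<open>a div b = 1\<close> \<open>a mod b = a - b\<close> show ?thesis
      by (simp add: frac_power_def)
  qed
  have le: "(a - b) * m \<le> b * m" for m
    using assms by (intro mult_right_mono) auto
  have "is_frac_power a b (w [i \<rightarrow> j]) \<longleftrightarrow> (\<exists>m > 0. j = i + b * m + (a - b) * m \<and>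
      (\<forall>x < (a - b) * m. w (i + x) = w (i + b * m + x)))" (is "?L \<longleftrightarrow> ?R") for i j
  proof
    assume ?L
    then obtain v m where v: "v \<noteq> []" "length v = b * m" "w [i \<rightarrow> j] = v @ take ((a - b) * m) v"
      unfolding is_frac_power_def by (metis dvdE power)
    have m: "m > 0"
      using v(1,2) by (cases m) auto
    have len: "j - i = b * m + (a - b) * m"
      using arg_cong[OF v(3), of length] v(2) le[of m] by simp
    have "b * m > 0"
      using m assms by simp
    with len have j: "j = i + b * m + (a - b) * m"
      by linarith
    have "w (i + x) = w (i + b * m + x)" if "x < (a - b) * m" for x
    proof -
      have "(w [i \<rightarrow> j]) ! x = (w [i \<rightarrow> j]) ! (b * m + x)"
        unfolding v(3) using that v(2) order_less_le_trans[OF that le] by (simp add: nth_append)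
      then show ?thesis
        using that j by (simp add: subsequence_def add.assoc)
    qed
    with m j show ?R by blast
  next
    assume ?R
    then obtain m where m: "m > 0" "j = i + b * m + (a - b) * m"
      "\<And>x. x < (a - b) * m \<Longrightarrow> w (i + x) = w (i + b * m + x)" by blast
    let ?v = "w [i \<rightarrow> i + b * m]"
    have len: "length ?v = b * m" by simp
    have "w [i \<rightarrow> j] = ?v @ take ((a - b) * m) ?v"
    proof (rule nth_equalityI)
      show "length (w [i \<rightarrow> j]) = length (?v @ take ((a - b) * m) ?v)"
        using m(2) le[of m] by simp
      fix x assume "x < length (w [i \<rightarrow> j])"
      then have x: "x < b * m + (a - b) * m"
        using m(2) by simp
      show "(w [i \<rightarrow> j]) ! x = (?v @ take ((a - b) * m) ?v) ! x"
      proof (cases "x < b * m")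
        case True
        then show ?thesis
          using m(2) by (simp add: subsequence_def nth_append add.assoc)
      next
        case False
        then have y: "x - b * m < (a - b) * m" "x - b * m < b * m"
          using x le[of m] by linarith+
        then show ?thesis
          using m(2) m(3)[OF y(1)] False by (simp add: subsequence_def nth_append add.assoc)
      qed
    qed
    moreover have "b * m > 0"
      using m assms by simp
    then have "?v \<noteq> []"
      using len by (metis length_0_conv less_irrefl)
    ultimately show ?L
      unfolding is_frac_power_def using power[OF len] len by (metis dvd_triv_left)
  qed
  then show ?thesis
    unfolding frac_power_free_def by blast
qed

text \<open>The nonzero positions are the residues \<open>0\<close>, \<open>b + c \<equiv> -4 c\<close>, \<open>b + 2 c \<equiv> -3 c\<close> and
  \<open>b + 4 c \<equiv> -c\<close>; the value \<open>W 0\<close> is junk.\<close>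

locale spike_word =
  fixes b c k :: nat and W :: "nat \<Rightarrow> nat"
  assumes b_less: "b < 2 * c" and c_less: "3 * c < 2 * b"
    and coprime_b_c: "coprime b c" and coprime_b_5: "coprime b 5"
    and k_eq: "k = 5 * c + b"
    and W_mult: "0 < t \<Longrightarrow> W (k * t) = Suc (W t)"
    and W_one: "x \<in> {b + c, b + 2 * c, b + 4 * c} \<Longrightarrow> W (k * q + x) = 1"
    and W_zero: "0 < x \<Longrightarrow> x < k \<Longrightarrow> x \<notin> {b + c, b + 2 * c, b + 4 * c} \<Longrightarrow> W (k * q + x) = 0"
begin

section \<open>Arithmetic of the nonzero positions modulo \<open>k\<close>\<close>

definition spike :: "nat \<Rightarrow> bool" where
  "spike t \<longleftrightarrow> t mod k \<in> {0, b + c, b + 2 * c, b + 4 * c}"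

lemma c_bounds: "2 \<le> c" "c < b"
  using b_less c_less by linarith+

lemma k_pos: "0 < k"
  using k_eq c_bounds by simp

lemma spike_add: "x < k \<Longrightarrow> spike (k * q + x) \<longleftrightarrow> x \<in> {0, b + c, b + 2 * c, b + 4 * c}"
  by (simp add: spike_def)

lemma spikes:
  "spike (k * q)" "spike (k * q + (b + c))" "spike (k * q + (b + 2 * c))"
  "spike (k * q + (b + 4 * c))" "spike (k * q + k)"
proof -
  have "b + c < k" "b + 2 * c < k" "b + 4 * c < k"
    using c_bounds k_eq by linarith+
  then show "spike (k * q)" "spike (k * q + (b + c))" "spike (k * q + (b + 2 * c))"
    "spike (k * q + (b + 4 * c))" "spike (k * q + k)"
    by (simp_all add: spike_def)
qed

lemma spike_iff:
  assumes "0 < t"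
  shows "spike t \<longleftrightarrow> W t \<noteq> 0"
proof (cases "t mod k = 0")
  case True
  then obtain q where "t = k * q" by auto
  with assms W_mult[of q] show ?thesis
    by (auto simp: spike_def)
next
  case False
  then have "0 < t mod k" "t mod k < k"
    using k_pos by simp_all
  then show ?thesis
    using W_one[of "t mod k" "t div k"] W_zero[of "t mod k" "t div k"]
    unfolding spike_def mult_div_mod_eq by (metis insert_iff less_irrefl zero_neq_one)
qed

lemma W_eq_if_not_dvd:
  assumes "\<not> k dvd s" "s mod k = t mod k"
  shows "W s = W t"
proof -
  have "0 < s mod k" "s mod k < k"
    using assms(1) k_pos by (auto simp: dvd_eq_mod_eq_0)
  then show ?thesis
    using W_one[of "s mod k" "s div k"] W_zero[of "s mod k" "s div k"]
      W_one[of "t mod k" "t div k"] W_zero[of "t mod k" "t div k"] assms(2)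
    by (metis mult_div_mod_eq)
qed

text \<open>Modulo \<open>k\<close>, \<open>b\<close> is -5 c, so the four residues are -\<alpha> c.
  Positions are then compared through the small coefficients \<alpha>.\<close>

lemma spikeE:
  assumes "spike t"
  obtains \<alpha> where "\<alpha> \<in> {0, 1, 3, 4 :: nat}" "k dvd t + \<alpha> * c"
proof -
  consider "t mod k = 0" | "t mod k = b + c" | "t mod k = b + 2 * c" | "t mod k = b + 4 * c"
    using assms by (auto simp: spike_def)
  then have "\<exists>\<alpha> \<in> {0, 1, 3, 4}. k dvd t mod k + \<alpha> * c"
    by cases (auto simp: k_eq algebra_simps)
  then show ?thesis
    using that by (metis dvd_eq_mod_eq_0 mod_add_left_eq)
qed

lemma coprime_c_k: "coprime c k"
proof -
  have "coprime c (5 * c + b)"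
    using coprime_b_c by (simp add: coprime_iff_gcd_eq_1 gcd.commute)
      (metis add.commute gcd_add_mult gcd.commute)
  then show ?thesis by (simp add: k_eq)
qed

text \<open>Modulo \<open>b\<close>, \<open>k\<close> is \<open>5 * c\<close>, and \<open>b\<close>
  is coprime to both factors.\<close>

lemma coprime_b_k: "coprime b k"
proof -
  have "coprime b (5 * c)"
    using coprime_b_c coprime_b_5 by simp
  then show ?thesis
    by (simp only: k_eq add.commute[of _ b] coprime_iff_gcd_eq_1 gcd_add2)
qed

lemma dvd_of_two_spikes:
  assumes "k dvd t + \<alpha> * c" "k dvd t + b * m + \<beta> * c"
  shows "int k dvd 5 * int m + int \<alpha> - int \<beta>"
proof -
  have "int k dvd int (t + \<alpha> * c)" "int k dvd int (t + b * m + \<beta> * c)"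
    using assms by (simp_all only: int_dvd_int_iff)
  \<comment> \<open>Adding k m turns -b m into 5 c m, so that the unit \<open>c\<close> factors out
    and cancels.\<close>
  then have "int k dvd int k * int m - (int (t + b * m + \<beta> * c) - int (t + \<alpha> * c))"
    by (intro dvd_diff) simp_all
  also have "\<dots> = int c * (5 * int m + int \<alpha> - int \<beta>)"
    by (simp add: k_eq algebra_simps)
  finally show ?thesis
    using coprime_c_k by (metis coprime_commute coprime_dvd_mult_right_iff coprime_int_iff)
qed

text \<open>Coefficients of at most 4 leave 5 m + \<alpha> - \<beta> strictly between 0 and
  \<open>k\<close>, where nothing is divisible by \<open>k\<close>.\<close>

lemma spikes_disjoint:
  assumes "0 < m" "5 * m + 4 < k" "spike t"
  shows "\<not> spike (t + b * m)"
proof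
  assume "spike (t + b * m)"
  then obtain \<beta> where \<beta>: "\<beta> \<in> {0, 1, 3, 4 :: nat}" "k dvd t + b * m + \<beta> * c"
    by (rule spikeE)
  obtain \<alpha> where \<alpha>: "\<alpha> \<in> {0, 1, 3, 4 :: nat}" "k dvd t + \<alpha> * c"
    using assms(3) by (rule spikeE)
  have "int k dvd 5 * int m + int \<alpha> - int \<beta>"
    using \<alpha> \<beta> dvd_of_two_spikes by blast
  moreover have "0 < 5 * int m + int \<alpha> - int \<beta>" "5 * int m + int \<alpha> - int \<beta> < int k"
    using assms \<alpha>(1) \<beta>(1) by auto
  ultimately show False
    using zdvd_not_zless by blast
qed

section \<open>Windows that meet a nonzero position\<close>

text \<open>Consecutive nonzero positions are b + c, c, 2 c and c apart in each period, so b + c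
  consecutive positions never fit strictly between two of them.\<close>

lemma window_hits_spike:
  assumes "b + c \<le> L"
  shows "\<exists>x < L. spike (i + x)"
proof -
  define q r where "q = i div k" and "r = i mod k"
  have i: "i = k * q + r" and r: "r < k"
    using k_pos by (simp_all add: q_def r_def)
  \<comment> \<open>\<open>r\<close> is the start of the window within its period and
    \<open>y\<close> an offset from the same origin; \<open>y\<close> may be \<open>k\<close>, the
    nonzero position opening the next period.\<close>
  have hit: ?thesis if "spike (k * q + y)" "r \<le> y" "y < r + L" for y
    using that i by (intro exI[of _ "y - r"]) auto
  note bounds = assms c_bounds k_eq r
  consider "r = 0" | "0 < r" "r \<le> b + c" | "b + c < r" "r \<le> b + 2 * c"
    | "b + 2 * c < r" "r \<le> b + 4 * c" | "b + 4 * c < r" by linarith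
  then show ?thesis
  proof cases
    case 1 show ?thesis
      by (rule hit[of 0]) (use 1 bounds spikes(1) in simp_all)
  next
    case 2 show ?thesis by (rule hit[OF spikes(2)]) (use 2 bounds in linarith)+
  next
    case 3 show ?thesis by (rule hit[OF spikes(3)]) (use 3 bounds in linarith)+
  next
    case 4 show ?thesis by (rule hit[OF spikes(4)]) (use 4 bounds in linarith)+
  next
    case 5 show ?thesis by (rule hit[OF spikes(5)]) (use 5 bounds in linarith)+
  qed
qed

text \<open>The nonzero positions themselves miss only the starts 0 < r \<le> b and b + 2 c < r
  \<le> b + 3 c. Shifted back by \<open>b\<close> they lie at c, 2 c, 4 c, 5 c and catch these
  starts because c < b < 2 c.\<close>

lemma window_hits_shifted_spike_1: "\<exists>x < c. spike (i + x) \<or> spike (i + x + b)"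
proof -
  define q r where "q = i div k" and "r = i mod k"
  have i: "i = k * q + r" and r: "r < k"
    using k_pos by (simp_all add: q_def r_def)
  have hit: ?thesis if "spike (k * q + y)" "r \<le> y" "y < r + c" for y
    using that i by (intro exI[of _ "y - r"]) auto
  have shifted: ?thesis if "spike (k * q + z)" "z = y + b" "r \<le> y" "y < r + c" for y z
    using that i by (intro exI[of _ "y - r"]) (auto simp: add.assoc)
  note bounds = b_less c_less c_bounds k_eq r
  consider "r = 0" | "0 < r" "r \<le> c" | "c < r" "r \<le> 2 * c" | "2 * c < r" "r \<le> b + c"
    | "b + c < r" "r \<le> b + 2 * c" | "b + 2 * c < r" "r \<le> 4 * c" | "4 * c < r" "r \<le> 5 * c"
    | "5 * c < r" "r \<le> b + 4 * c" | "b + 4 * c < r" by linarith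
  then show ?thesis
  proof cases
    case 1 show ?thesis
      by (rule hit[of 0]) (use 1 bounds spikes(1) in simp_all)
  next
    case 2 show ?thesis by (rule shifted[OF spikes(2), of c]) (use 2 bounds in linarith)+
  next
    case 3 show ?thesis by (rule shifted[OF spikes(3), of "2 * c"]) (use 3 bounds in linarith)+
  next
    case 4 show ?thesis by (rule hit[OF spikes(2)]) (use 4 bounds in linarith)+
  next
    case 5 show ?thesis by (rule hit[OF spikes(3)]) (use 5 bounds in linarith)+
  next
    case 6 show ?thesis by (rule shifted[OF spikes(4), of "4 * c"]) (use 6 bounds in linarith)+
  next
    case 7 show ?thesis by (rule shifted[OF spikes(5), of "5 * c"]) (use 7 bounds in linarith)+
  next
    case 8 show ?thesis by (rule hit[OF spikes(4)]) (use 8 bounds in linarith)+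
  next
    case 9 show ?thesis by (rule hit[OF spikes(5)]) (use 9 bounds in linarith)+
  qed
qed

text \<open>Only the starts 0 < r \<le> b - c are missed. The positions b + 2 c and b + 4 c, shifted
  back by 2 b to 2 c - b and 4 c - b, catch them.\<close>

lemma window_hits_shifted_spike_2: "\<exists>x < 2 * c. spike (i + x) \<or> spike (i + x + 2 * b)"
proof -
  define q r where "q = i div k" and "r = i mod k"
  have i: "i = k * q + r" and r: "r < k"
    using k_pos by (simp_all add: q_def r_def)
  have hit: ?thesis if "spike (k * q + y)" "r \<le> y" "y < r + 2 * c" for y
    using that i by (intro exI[of _ "y - r"]) auto
  have shifted: ?thesis if "spike (k * q + z)" "z = y + 2 * b" "r \<le> y" "y < r + 2 * c" for y z
    using that i by (intro exI[of _ "y - r"]) (auto simp: add.assoc)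
  note bounds = b_less c_less c_bounds k_eq r
  consider "r = 0" | "0 < r" "r + b \<le> 2 * c" | "2 * c < r + b" "r + b \<le> 4 * c"
    | "4 * c < r + b" "r \<le> b + c" | "b + c < r" "r \<le> b + 2 * c"
    | "b + 2 * c < r" "r \<le> b + 4 * c" | "b + 4 * c < r" by linarith
  then show ?thesis
  proof cases
    case 1 show ?thesis
      by (rule hit[of 0]) (use 1 bounds spikes(1) in simp_all)
  next
    case 2 show ?thesis
      by (rule shifted[OF spikes(3), of "2 * c - b"]) (use 2 bounds in linarith)+
  next
    case 3 show ?thesis
      by (rule shifted[OF spikes(4), of "4 * c - b"]) (use 3 bounds in linarith)+
  next
    case 4 show ?thesis by (rule hit[OF spikes(2)]) (use 4 bounds in linarith)+
  next
    case 5 show ?thesis by (rule hit[OF spikes(3)]) (use 5 bounds in linarith)+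
  next
    case 6 show ?thesis by (rule hit[OF spikes(4)]) (use 6 bounds in linarith)+
  next
    case 7 show ?thesis by (rule hit[OF spikes(5)]) (use 7 bounds in linarith)+
  qed
qed

section \<open>Absence of repetitions\<close>

text \<open>Otherwise the shift by b m maps nonzero residues to nonzero residues. The images of -4 c
  and 0 have coefficients \<beta> and \<gamma> that differ by 4 modulo \<open>k\<close>, and k > 8
  forces \<beta> = 4, \<gamma> = 0. So the residue 0 is fixed and \<open>k\<close> divides b m,
  hence m.\<close>

lemma full_period_mismatch:
  assumes "k \<le> L" "\<not> k dvd m"
  shows "\<exists>x < L. spike (i + x) \<noteq> spike (i + x + b * m)"
proof (rule ccontr)
  assume neg: "\<not> ?thesis"
  have reach: "\<exists>t. spike t = spike (t + b * m) \<and> t mod k = r" if "r < k" for r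
  proof -
    \<comment> \<open>The least offset that takes \<open>i\<close> to the residue
      \<open>r\<close>.\<close>
    define x where "x = (r + (k - i mod k)) mod k"
    have "(i + x) mod k = (i mod k + (r + (k - i mod k))) mod k"
      unfolding x_def by (simp add: mod_add_eq mod_simps)
    also have "i mod k + (r + (k - i mod k)) = r + k"
      using k_pos mod_less_divisor[of k i] by linarith
    finally have "(i + x) mod k = r"
      using that by simp
    moreover have "x < L"
      using assms(1) k_pos mod_less_divisor[of k "r + (k - i mod k)"] unfolding x_def by linarith
    ultimately show ?thesis
      using neg by blast
  qed
  have "b + c < k" using k_eq c_bounds by linarith
  from reach[OF this] obtain s where s: "s mod k = b + c" "spike s = spike (s + b * m)"
    by blast
  then have s': "spike (s + b * m)"
    by (simp add: spike_def)
  from reach[OF k_pos] obtain t where t_eq: "spike t = spike (t + b * m) \<and> t mod k = 0" ..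
  then have t: "t mod k = 0" ..
  then have "spike t" by (simp add: spike_def)
  with t_eq have t': "spike (t + b * m)" by simp
  obtain \<beta> where \<beta>: "\<beta> \<in> {0, 1, 3, 4 :: nat}" "k dvd s + b * m + \<beta> * c"
    using s' by (rule spikeE)
  obtain \<gamma> where \<gamma>: "\<gamma> \<in> {0, 1, 3, 4 :: nat}" "k dvd t + b * m + \<gamma> * c"
    using t' by (rule spikeE)
  have "(s + 4 * c) mod k = (b + c + 4 * c) mod k"
    using s(1) by (metis mod_add_left_eq)
  then have "k dvd s + 4 * c"
    by (simp add: k_eq dvd_eq_mod_eq_0 add.commute)
  then have 1: "int k dvd 5 * int m + int 4 - int \<beta>"
    using \<beta>(2) by (rule dvd_of_two_spikes)
  have "k dvd t + 0 * c"
    using t by auto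
  then have 2: "int k dvd 5 * int m + int 0 - int \<gamma>"
    using \<gamma>(2) by (rule dvd_of_two_spikes)
  have "int k dvd (4 - int \<beta>) + int \<gamma>"
    using dvd_diff[OF 1 2] by (simp add: algebra_simps)
  moreover have "8 < k"
    using k_eq c_bounds by simp
  then have "(4 - int \<beta>) + int \<gamma> < int k" "0 \<le> (4 - int \<beta>) + int \<gamma>"
    using \<beta>(1) \<gamma>(1) by auto
  ultimately have "(4 - int \<beta>) + int \<gamma> = 0"
    using zdvd_not_zless by (metis order_le_imp_less_or_eq)
  then have "\<gamma> = 0"
    using \<beta>(1) by auto
  with t \<gamma> have "k dvd b * m"
    by (metis add_0_right dvd_add_right_iff dvd_eq_mod_eq_0 mult_0)
  then show False
    using assms(2) coprime_b_k by (simp add: coprime_dvd_mult_right_iff coprime_commute)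
qed

text \<open>From c m < k < 7 c follow m \<le> 6 and then k \<le> 34, so only finitely many triples
  remain.\<close>

lemma small_mismatch:
  assumes "k \<le> 5 * m + 4" "c * m < k"
  shows "\<exists>x < c * m. spike (i + x) \<noteq> spike (i + x + b * m)"
proof -
  have "c * m < c * 7"
    using assms(2) b_less k_eq by linarith
  then have m: "m \<le> 6" by simp
  then have "5 * c + b \<le> 34"
    using assms(1) k_eq by simp
  then have "c = 2 \<or> c = 3 \<or> c = 4 \<or> c = 5"
    using c_less c_bounds by linarith
  \<comment> \<open>For \<open>c = 2\<close> no \<open>b\<close> satisfies the bounds, and for
    \<open>c = 3\<close> only \<open>b = 5\<close> does.\<close>
  moreover have "b \<noteq> 5"
    using coprime_b_5 by auto
  ultimately have "c = 4 \<and> b = 7 \<or> c = 5 \<and> b = 8 \<or> c = 5 \<and> b = 9"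
    using b_less c_less by (elim disjE) auto
  moreover have "m = 5 \<or> m = 6" if "c = 4 \<and> b = 7"
    using that assms k_eq by simp linarith
  moreover have "m = 6" if "c = 5 \<and> b = 8 \<or> c = 5 \<and> b = 9"
    using that assms m k_eq by auto
  ultimately have cases: "(b, c, m) \<in> {(7, 4, 5), (7, 4, 6), (8, 5, 6), (9, 5, 6)}"
    by auto
  \<comment> \<open>The start of the window matters only through its residue \<open>r\<close>, which
    makes the claim closed and finite; lists make it executable.\<close>
  have check: "\<forall>(b, c, m) \<in> set [(7, 4, 5), (7, 4, 6), (8, 5, 6), (9, 5, 6)].
      \<forall>r \<in> set [0..<5 * c + b]. \<exists>x \<in> set [0..<c * m].
        ((r + x) mod (5 * c + b) \<in> set [0, b + c, b + 2 * c, b + 4 * c]) \<noteq>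
        ((r + x + b * m) mod (5 * c + b) \<in> set [0, b + c, b + 2 * c, b + 4 * c :: nat])"
    by code_simp
  have "(b, c, m) \<in> set [(7, 4, 5), (7, 4, 6), (8, 5, 6), (9, 5, 6)]"
    using cases by simp
  from bspec[OF check this, unfolded prod.case list.set, folded k_eq, folded spike_def]
  have "\<exists>x \<in> set [0..<c * m]. spike (i mod k + x) \<noteq> spike (i mod k + x + b * m)"
    using k_pos by simp
  then show ?thesis
    by (auto simp: spike_def mod_simps add.assoc)
qed

lemma spike_mismatch:
  assumes "0 < m" "\<not> k dvd m"
  shows "\<exists>x < c * m. spike (i + x) \<noteq> spike (i + x + b * m)"
proof -
  consider "k \<le> c * m" | "c * m < k" "k \<le> 5 * m + 4" | "5 * m + 4 < k" by linarith
  then show ?thesis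
  proof cases
    case 1 then show ?thesis using assms(2) by (rule full_period_mismatch)
  next
    case 2 then show ?thesis using small_mismatch by blast
  next
    case 3
    \<comment> \<open>In this range nonzero positions are never b m apart, so a single one in either
      window is already a mismatch.\<close>
    have "\<exists>x < c * m. spike (i + x) \<or> spike (i + x + b * m)"
    proof -
      consider "m = 1" | "m = 2" | "3 \<le> m" using assms(1) by linarith
      then show ?thesis
      proof cases
        case 1 then show ?thesis using window_hits_shifted_spike_1 by simp
      next
        case 2 then show ?thesis using window_hits_shifted_spike_2 by (simp add: mult.commute)
      next
        case 3
        then have "b + c \<le> c * m"
          using mult_le_mono2[OF 3, of c] b_less by linarith
        then show ?thesis using window_hits_spike by blast
      qed
    qed
    then show ?thesis
      using spikes_disjoint[OF assms(1) 3] by blast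
  qed
qed

text \<open>Descent on \<open>m\<close>: if \<open>k\<close> divides \<open>m\<close>, the multiples
  of \<open>k\<close> in the window, read through \<open>W_mult\<close>, form a window for
  \<open>m div k\<close>.\<close>

lemma no_repetition:
  assumes "0 < i" "0 < m"
  shows "\<exists>x < c * m. W (i + x) \<noteq> W (i + b * m + x)"
  using assms
proof (induction m arbitrary: i rule: less_induct)
  case (less m)
  show ?case
  proof (cases "k dvd m")
    case False
    then obtain x where "x < c * m" "spike (i + x) \<noteq> spike (i + x + b * m)"
      using spike_mismatch less.prems by blast
    then have "x < c * m" "W (i + x) \<noteq> W (i + b * m + x)"
      using less.prems spike_iff[of "i + x"] spike_iff[of "i + x + b * m"]
      by (auto simp: algebra_simps)
    then show ?thesis by blast
  next
    case True
    then obtain m' where m: "m = k * m'" by blast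
    \<comment> \<open>Rounded up, so that \<open>k * i'\<close> is the first multiple of
      \<open>k\<close> not before \<open>i\<close>.\<close>
    define i' where "i' = (i + k - 1) div k"
    have "k * i' \<le> i + k - 1" "i + k - 1 < k * i' + k"
      unfolding i'_def using dividend_less_times_div[OF k_pos, of "i + k - 1"] by simp_all
    then have i': "i \<le> k * i'" "k * i' < i + k"
      using k_pos less.prems by auto
    have "0 < i'"
      using i' less.prems by (cases i') auto
    have m': "0 < m'" "m' < m"
      using m less.prems k_eq c_bounds by auto
    obtain x where x: "x < c * m'" "W (i' + x) \<noteq> W (i' + b * m' + x)"
      using less.IH[OF m'(2) \<open>0 < i'\<close> m'(1)] by blast
    define y where "y = k * i' + k * x - i"
    have iy: "i + y = k * (i' + x)" "i + b * m + y = k * (i' + b * m' + x)"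
      using i' by (simp_all add: y_def m algebra_simps)
    have "k * Suc x \<le> k * (c * m')"
      using x(1) by (intro mult_le_mono2) simp
    then have "y < c * m"
      using i' by (simp add: y_def m algebra_simps)
    moreover have "W (i + y) \<noteq> W (i + b * m + y)"
      using x(2) \<open>0 < i'\<close> by (simp add: iy W_mult)
    ultimately show ?thesis by blast
  qed
qed

section \<open>Decreasing a letter completes a repetition\<close>

text \<open>The power is read backwards from its last position \<open>t\<close>. The case j = 0 is
  stated separately, since there the letter put in place of \<open>W t\<close> has to match.\<close>

lemma repetition_if_zero:
  assumes "0 < t" "spike t"
  shows "\<exists>m > 0. (b + c) * m \<le> t \<and> W (t - b * m) = 0 \<and>
    (\<forall>j. 0 < j \<and> j < c * m \<longrightarrow> W (t - j) = W (t - b * m - j))"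
proof -
  \<comment> \<open>The offset runs from 1 to \<open>k\<close>, so that a multiple of
    \<open>k\<close> closes a block and the whole power fits into the block before it.\<close>
  define q r where "q = (t - 1) div k" and "r = Suc ((t - 1) mod k)"
  have t: "t = k * q + r" and r: "0 < r" "r \<le> k"
    using assms(1) k_pos by (simp_all add: q_def r_def Suc_leI)
  have r_cases: "r \<in> {b + c, b + 2 * c, b + 4 * c, k}"
    using assms r by (cases "r = k") (auto simp: t spike_add)
  have zero: "W (t - j) = 0" if "j < r" "r - j < k" "r - j \<notin> {b + c, b + 2 * c, b + 4 * c}" for j
    using W_zero[of "r - j" q] that by (simp add: t)
  have sub: "t - b * m - j = t - (b * m + j)" for m j by simp
  have zeros: ?thesis
    if "0 < m" "(b + c) * m \<le> r"
      "\<And>j. 0 < j \<Longrightarrow> j < c * m \<Longrightarrow> r - j < k \<and> r - j \<notin> {b + c, b + 2 * c, b + 4 * c}"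
      "\<And>j. j < c * m \<Longrightarrow> r - (b * m + j) < k \<and> r - (b * m + j) \<notin> {b + c, b + 2 * c, b + 4 * c}" for m
  proof (intro exI[of _ m] conjI allI impI)
    have bound: "b * m + j < r" if "j < c * m" for j
      using that \<open>(b + c) * m \<le> r\<close> by (simp add: algebra_simps)
    show "0 < m" "(b + c) * m \<le> t"
      using that t by simp_all
    have "0 < c * m"
      using that(1) c_bounds by simp
    then show "W (t - b * m) = 0"
      using zero[of "b * m"] bound[of 0] that(4)[of 0] by simp
    fix j assume j: "0 < j \<and> j < c * m"
    then have "j < r" using bound[of j] by simp
    then show "W (t - j) = W (t - b * m - j)"
      unfolding sub using j zero[of j] zero[of "b * m + j"] bound[of j] that(3,4)[of j] by simp
  qed
  \<comment> \<open>At r = b + 4 c the choice m = 1 fails: the nonzero offset b + 2 c lies in the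
    block compared with, as c < b < 2 c.\<close>
  show ?thesis
  proof (cases "r = b + 4 * c")
    case True
    show ?thesis
      using True b_less c_less k_eq by (intro zeros[of 2]) auto
  next
    case False
    then show ?thesis
      using r_cases b_less c_less k_eq by (intro zeros[of 1]) auto
  qed
qed

text \<open>A letter above 1 occurs only at multiples of \<open>k\<close>, so lowering it to a
  positive value reduces to position t / k and value u - 1.\<close>

lemma repetition_if_decreased:
  assumes "0 < t" "u < W t"
  shows "\<exists>m > 0. (b + c) * m \<le> t \<and> W (t - b * m) = u \<and>
    (\<forall>j. 0 < j \<and> j < c * m \<longrightarrow> W (t - j) = W (t - b * m - j))"
  using assms
proof (induction t arbitrary: u rule: less_induct)
  case (less t)
  show ?case
  proof (cases u)
    case 0
    then show ?thesis
      using repetition_if_zero[of t] spike_iff[of t] less.prems by auto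
  next
    case (Suc u')
    have "k dvd t"
    proof (rule ccontr)
      assume "\<not> k dvd t"
      then have "W t \<le> 1"
        using W_one[of "t mod k" "t div k"] W_zero[of "t mod k" "t div k"] k_pos
        by (metis dvd_eq_mod_eq_0 le_refl mod_less_divisor mult_div_mod_eq neq0_conv zero_le_one)
      then show False using less.prems Suc by simp
    qed
    then obtain t' where t: "t = k * t'" by blast
    have t': "0 < t'" "t' < t"
      using t less.prems k_eq c_bounds by auto
    moreover have "u' < W t'"
      using less.prems Suc t t' W_mult by simp
    ultimately obtain m where m: "0 < m" "(b + c) * m \<le> t'" "W (t' - b * m) = u'"
      "\<And>j. 0 < j \<and> j < c * m \<Longrightarrow> W (t' - j) = W (t' - b * m - j)"
      using less.IH[OF t'(2,1)] by blast
    \<comment> \<open>This keeps every compared position positive, away from the junk value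
      \<open>W 0\<close>.\<close>
    have pos: "b * m + j < t'" if "j < c * m" for j
      using that m(2) by (simp add: algebra_simps)
    have "0 < c * m" using m(1) c_bounds by simp
    show ?thesis
    proof (intro exI[of _ "k * m"] conjI allI impI)
      show "0 < k * m" using m k_pos by simp
      have "k * ((b + c) * m) \<le> k * t'" using m(2) by simp
      then show "(b + c) * (k * m) \<le> t" by (simp add: t algebra_simps)
      have "t - b * (k * m) = k * (t' - b * m)"
        by (simp add: t algebra_simps diff_mult_distrib2)
      then show "W (t - b * (k * m)) = u"
        using m(3) pos[OF \<open>0 < c * m\<close>] Suc by (simp add: W_mult)
      fix j assume j: "0 < j \<and> j < c * (k * m)"
      \<comment> \<open>The compared positions differ by a multiple of \<open>k\<close>, so off the
        multiples of \<open>k\<close> periodicity alone makes the letters equal.\<close>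
      have shift: "t - j = (t - b * (k * m) - j) + k * (b * m)"
      proof -
        have "k * ((b + c) * m) \<le> k * t'" using m(2) by simp
        then have "b * (k * m) + j \<le> t" using j by (simp add: t algebra_simps)
        then show ?thesis by (simp add: algebra_simps)
      qed
      show "W (t - j) = W (t - b * (k * m) - j)"
      proof (cases "k dvd j")
        case True
        then obtain j' where j': "j = k * j'" by blast
        have j'': "0 < j' \<and> j' < c * m" using j j' k_pos by auto
        have "t - j = k * (t' - j')" "t - b * (k * m) - j = k * (t' - b * m - j')"
          by (simp_all add: t j' algebra_simps diff_mult_distrib2)
        then show ?thesis
          using m(4)[OF j''] pos[of j'] j'' by (simp add: W_mult)
      next
        case False
        have "j < t"
          using shift j m(2) t t'
          by (metis False \<open>k dvd t\<close> add_is_0 dvd_add_triv_right_iff dvd_refl not_less_iff_gr_or_eq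
              diff_is_0_eq less_imp_le k_pos m(1) mult_is_0 c_bounds not_less_zero less_nat_zero_code le_less)
        then have "\<not> k dvd t - j"
          using False \<open>k dvd t\<close> by (metis dvd_diffD1 less_imp_le)
        then show ?thesis
          by (rule W_eq_if_not_dvd) (simp add: shift)
      qed
    qed
  qed
qed

end

section \<open>Regularity\<close>

text \<open>Every kernel sequence is an affine function of \<open>s\<close>, so the kernel and the
  pair of \<open>s\<close> and the constant 1 generate the same module.\<close>

lemma regular_sequence_of_recurrence:
  fixes s :: "nat \<Rightarrow> int" and k :: nat
  assumes "0 < k"
    and const: "\<And>j. j < k - 1 \<Longrightarrow> \<exists>d. \<forall>i. s (k * i + j) = d"
    and succ: "\<And>i. s (k * i + (k - 1)) = s i + 1"
  shows "regular_sequence k s"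
proof -
  let ?one = "(\<lambda>_. 1) :: nat \<Rightarrow> int"
  have affine: "\<exists>p q. \<forall>i. s (k ^ e * i + j) = p * s i + q" if "j < k ^ e" for e j
    using that
  proof (induction e arbitrary: j)
    case 0
    then show ?case by (intro exI[of _ 1] exI[of _ 0]) simp
  next
    case (Suc e)
    \<comment> \<open>The lowest base-k digit \<open>j0\<close> decides: below k - 1 the sequence is
      constant, at k - 1 it is one more than the sequence for \<open>j1\<close>.\<close>
    define j1 j0 where "j1 = j div k" and "j0 = j mod k"
    have j: "j = k * j1 + j0" "j0 < k"
      using assms(1) by (simp_all add: j1_def j0_def)
    have "j1 < k ^ e"
      using Suc.prems assms(1) by (simp add: j1_def div_less_iff_less_mult mult.commute)
    then obtain p q where pq: "\<And>i. s (k ^ e * i + j1) = p * s i + q"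
      using Suc.IH by blast
    have split: "k ^ Suc e * i + j = k * (k ^ e * i + j1) + j0" for i
      by (simp add: j(1) algebra_simps)
    show ?case
    proof (cases "j0 < k - 1")
      case True
      then obtain d where "\<And>i. s (k * i + j0) = d" using const by blast
      then show ?thesis
        unfolding split by (intro exI[of _ 0] exI[of _ d]) simp
    next
      case False
      then have "j0 = k - 1" using j(2) by simp
      then show ?thesis
        unfolding split \<open>j0 = k - 1\<close> succ pq by (intro exI[of _ p] exI[of _ "q + 1"]) simp
    qed
  qed
  have mem: "(\<lambda>i. s (k ^ e * i + j)) \<in> kernel k s" if "j < k ^ e" for e j
    using that unfolding kernel_def by (intro CollectI exI[of _ e] exI[of _ j]) auto
  have "kernel k s \<subseteq> int_seq_span {s, ?one}"
  proof
    fix f assume "f \<in> kernel k s"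
    then obtain e j where f: "f = (\<lambda>i. s (k ^ e * i + j))" "j \<le> k ^ e - 1"
      unfolding kernel_def by blast
    have "j < k ^ e" using f(2) assms(1) by (simp add: Suc_le_lessD le_diff_conv2 less_eq_Suc_le)
    then obtain p q where "f = (\<lambda>i. p * s i) + (\<lambda>i. q * ?one i)"
      using affine f(1) by (fastforce simp: fun_eq_iff)
    then show "f \<in> int_seq_span {s, ?one}"
      by (simp only:) (intro int_seq.span_add int_seq.span_scale int_seq.span_base; simp)
  qed
  moreover have "s \<in> int_seq_span (kernel k s)"
    using mem[of 0 0] by (intro int_seq.span_base) simp
  moreover have "?one \<in> int_seq_span (kernel k s)"
  proof -
    \<comment> \<open>The constant 1 is the difference of two kernel sequences.\<close>
    have "(\<lambda>i. s (k ^ 1 * i + (k - 1))) - s \<in> int_seq_span (kernel k s)"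
      by (rule int_seq.span_diff[OF int_seq.span_base[OF mem]
            \<open>s \<in> int_seq_span (kernel k s)\<close>]) (use assms(1) in simp)
    also have "(\<lambda>i. s (k ^ 1 * i + (k - 1))) - s = ?one"
      by (simp add: fun_eq_iff succ[simplified])
    finally show ?thesis .
  qed
  ultimately have "int_seq_span {s, ?one} = int_seq_span (kernel k s)"
    by (intro int_seq.span_eq[THEN iffD2]) auto
  then show ?thesis
    unfolding regular_sequence_def by (intro exI[of _ "{s, ?one}"] conjI) simp_all
qed

section \<open>Letters of the fixed point and conclusion\<close>

lemma nth_block:
  "(replicate m x @ y # ys) ! j = (if j < m then x else if j = m then y else ys ! (j - Suc m))"
  by (simp add: nth_append nth_Cons')

lemma nth_phi:
  assumes "b < a" "j < 5 * a - 4 * b"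
  shows "phi a b n ! j =
    (if j = a - 1 \<or> j = 2 * a - b - 1 \<or> j = 4 * a - 3 * b - 1 then 1
     else if j = 5 * a - 4 * b - 1 then n + 1 else 0)"
proof -
  \<comment> \<open>Written in \<open>b\<close> and \<open>d\<close>, the block lengths involve no
    truncated subtraction.\<close>
  define d where "d = a - b - 1"
  have a: "a = Suc (b + d)"
    using assms(1) by (simp add: d_def)
  have gaps: "a - 1 = b + d" "a - b - 1 = d" "2 * a - 2 * b - 1 = Suc (2 * d)"
    unfolding a by simp_all
  have phi: "phi a b n = replicate (b + d) 0 @ 1 # replicate d 0 @ 1 #
      replicate (Suc (2 * d)) 0 @ 1 # replicate d 0 @ [n + 1]"
    unfolding phi_def gaps by simp
  have pos: "2 * a - b - 1 = b + 2 * d + 1" "4 * a - 3 * b - 1 = b + 4 * d + 3"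
    "5 * a - 4 * b - 1 = b + 5 * d + 4"
    unfolding a by simp_all
  have "j \<le> b + 5 * d + 4"
    using assms(2) pos(3) by linarith
  then consider "j < b + d" | "j = b + d" | y where "j = b + d + 1 + y" "y < d"
    | "j = b + 2 * d + 1" | y where "j = b + 2 * d + 2 + y" "y < Suc (2 * d)"
    | "j = b + 4 * d + 3" | y where "j = b + 4 * d + 4 + y" "y < d" | "j = b + 5 * d + 4"
  proof -
    assume cases: "j < b + d \<Longrightarrow> thesis" "j = b + d \<Longrightarrow> thesis"
      "\<And>y. j = b + d + 1 + y \<Longrightarrow> y < d \<Longrightarrow> thesis" "j = b + 2 * d + 1 \<Longrightarrow> thesis"
      "\<And>y. j = b + 2 * d + 2 + y \<Longrightarrow> y < Suc (2 * d) \<Longrightarrow> thesis"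
      "j = b + 4 * d + 3 \<Longrightarrow> thesis"
      "\<And>y. j = b + 4 * d + 4 + y \<Longrightarrow> y < d \<Longrightarrow> thesis" "j = b + 5 * d + 4 \<Longrightarrow> thesis"
    consider "j < b + d" | "j = b + d" | "b + d < j" "j < b + 2 * d + 1" | "j = b + 2 * d + 1"
      | "b + 2 * d + 1 < j" "j < b + 4 * d + 3" | "j = b + 4 * d + 3"
      | "b + 4 * d + 3 < j" "j < b + 5 * d + 4" | "j = b + 5 * d + 4"
      using \<open>j \<le> b + 5 * d + 4\<close> less_linear[of j "b + d"] less_linear[of j "b + 2 * d + 1"]
        less_linear[of j "b + 4 * d + 3"] unfolding le_less by blast
    then show thesis
    proof cases
      case 3 show thesis by (rule cases(3)[of "j - (b + d + 1)"]) (use 3 in linarith)+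
    next
      case 5 show thesis by (rule cases(5)[of "j - (b + 2 * d + 2)"]) (use 5 in linarith)+
    next
      case 7 show thesis by (rule cases(7)[of "j - (b + 4 * d + 4)"]) (use 7 in linarith)+
    qed (use cases in blast)+
  qed
  then show ?thesis
    unfolding phi pos gaps(1) by cases (simp_all add: nth_block del: replicate_Suc)
qed

theorem theorem5p1:
  fixes a b :: nat
  assumes "0 < a" and "0 < b" and "coprime a b"
    and "3 / 2 < real a / real b" and "real a / real b < 5 / 3"
    and "gcd b 5 = 1"
  shows "least_word a b = morph_limit (phi a b) 0 \<and> 5 * a - 4 * b \<in> rho a b"
proof -
  define c k where "c = a - b" and "k = 5 * a - 4 * b"
  have "3 * real b < 2 * real a" "3 * real a < 5 * real b"
    using assms(2,4,5) by (simp_all add: field_simps)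
  then have ab: "3 * b < 2 * a" "3 * a < 5 * b"
    by linarith+
  then have a: "a = b + c" and k: "k = 5 * c + b" and bc: "b < 2 * c" "3 * c < 2 * b"
    by (auto simp: c_def k_def)
  have "2 \<le> c" "c < b" using bc by linarith+
  define w where "w = morph_limit (phi a b) 0"
  have "\<exists>!w. w 0 = 0 \<and> morph_image (phi a b) w w"
    using \<open>2 \<le> c\<close> a k uniform_phi[of b a] hd_phi[of a b 0]
    by (intro ex1_fixed_point[of k]) (auto simp: k_def)
  then have "w 0 = 0 \<and> morph_image (phi a b) w w"
    unfolding w_def morph_limit_def by (rule theI')
  then have "(w [k * i \<rightarrow> k * i + k]) = phi a b (w i)" for i
    using morph_image_uniform_iff[of k "phi a b" w w] uniform_phi[of b a] a k \<open>2 \<le> c\<close>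
    by (auto simp: k_def)
  then have w_phi: "w (k * i + j) = phi a b (w i) ! j" if "j < k" for i j
    using that by (metis add_diff_cancel_left' subsequence_nth less_diff_conv add.commute)
  have w_rec: "w (k * i + j) =
      (if j = a - 1 \<or> j = 2 * a - b - 1 \<or> j = 4 * a - 3 * b - 1 then 1
       else if j = k - 1 then w i + 1 else 0)" if "j < k" for i j
    unfolding w_phi[OF that] unfolding k_def
    by (rule nth_phi) (use that a \<open>2 \<le> c\<close> in \<open>simp_all add: k_def\<close>)
  \<comment> \<open>Counting from 1 puts the last letter of each block, the only one that depends on
    \<open>w\<close>, at the multiples of \<open>k\<close>.\<close>
  define W where "W t = w (t - 1)" for t
  have W_add: "W (k * q + x) =
      (if x = b + c \<or> x = b + 2 * c \<or> x = b + 4 * c then 1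
       else if x = k then w q + 1 else 0)" if "0 < x" "x \<le> k" for q x
  proof -
    have "x - 1 = a - 1 \<longleftrightarrow> x = b + c" "x - 1 = 2 * a - b - 1 \<longleftrightarrow> x = b + 2 * c"
      "x - 1 = 4 * a - 3 * b - 1 \<longleftrightarrow> x = b + 4 * c" "x - 1 = k - 1 \<longleftrightarrow> x = k"
      using that a \<open>2 \<le> c\<close> by linarith+
    moreover have "W (k * q + x) = w (k * q + (x - 1))" "x - 1 < k"
      using that by (simp_all add: W_def)
    ultimately show ?thesis
      by (simp only: w_rec)
  qed
  interpret spike_word b c k W
  proof unfold_locales
    show "b < 2 * c" "3 * c < 2 * b" "k = 5 * c + b"
      by (rule bc k)+
    show "coprime b c"
      using assms(3) by (simp only: a coprime_iff_gcd_eq_1 gcd.commute[of _ b] gcd_add2)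
    show "coprime b 5"
      using assms(6) by (simp add: coprime_iff_gcd_eq_1)
    show "W (k * t) = Suc (W t)" if "0 < t" for t
    proof -
      have "k * t = k * (t - 1) + k" using that by (cases t) auto
      then show ?thesis
        using W_add[of k "t - 1"] k \<open>2 \<le> c\<close> by (simp add: W_def)
    qed
    show "W (k * q + x) = 1" if "x \<in> {b + c, b + 2 * c, b + 4 * c}" for x q
      using W_add[of x q] that k \<open>2 \<le> c\<close> by auto
    show "W (k * q + x) = 0" if "0 < x" "x < k" "x \<notin> {b + c, b + 2 * c, b + 4 * c}" for x q
      using W_add[of x q] that by auto
  qed
  have "b < a" "a < 2 * b" using a \<open>2 \<le> c\<close> \<open>c < b\<close> by linarith+
  note free_iff = frac_power_free_iff_no_repetition[OF \<open>0 < b\<close> this, folded c_def]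
  have "frac_power_free a b w"
    unfolding free_iff
  proof (intro allI impI)
    fix i m :: nat assume "0 < m"
    then show "\<exists>x < c * m. w (i + x) \<noteq> w (i + b * m + x)"
      using no_repetition[of "Suc i" m] by (simp add: W_def)
  qed
  moreover have "w' = w \<or> less_fun w w'" if free: "frac_power_free a b w'" for w'
  proof (cases "w' = w")
    case False
    define n where "n = (LEAST n. w n \<noteq> w' n)"
    from False have "\<exists>n. w n \<noteq> w' n" by auto
    then have n: "w n \<noteq> w' n" unfolding n_def by (rule LeastI_ex)
    have below: "w i = w' i" if "i < n" for i
      using that unfolding n_def using not_less_Least by blast
    have "\<not> w' n < w n"
    proof
      assume "w' n < w n"
      then obtain m where m: "0 < m" "(b + c) * m \<le> Suc n" "W (Suc n - b * m) = w' n"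
        "\<And>j. 0 < j \<and> j < c * m \<Longrightarrow> W (Suc n - j) = W (Suc n - b * m - j)"
        using repetition_if_decreased[of "Suc n" "w' n"] by (auto simp: W_def)
      \<comment> \<open>The start of the power of length (b + c) m that ends at index
        \<open>n\<close>.\<close>
      define i where "i = Suc n - (b + c) * m"
      have i: "i + b * m + c * m = Suc n"
        using m(2) by (simp add: i_def algebra_simps)
      have "0 < b * m" using m(1) \<open>0 < b\<close> by simp
      have "w' (i + x) = w' (i + b * m + x)" if x: "x < c * m" for x
      proof -
        \<comment> \<open>\<open>j\<close> counts back from the end of the power, as in
          \<open>repetition_if_decreased\<close>.\<close>
        define j where "j = c * m - 1 - x"
        have eqs: "i + b * m + x = n - j" "i + x = n - b * m - j" "b * m + j \<le> n"
          using i x by (simp_all add: j_def)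
        have "i + x < n"
          using i x \<open>0 < b * m\<close> by linarith
        then have old: "w' (i + x) = w (i + x)"
          by (simp add: below)
        \<comment> \<open>Only j = 0 reaches index \<open>n\<close>, where \<open>w'\<close> has the
          lowered letter; all other indices lie before \<open>n\<close>, where \<open>w'\<close>
          agrees with \<open>w\<close>.\<close>
        show ?thesis
        proof (cases "j = 0")
          case True
          then show ?thesis
            using m(3) old eqs by (simp add: W_def)
        next
          case False
          then have "n - j < n"
            using eqs(3) \<open>0 < b * m\<close> by linarith
          then have "w' (n - j) = w (n - j)"
            by (simp add: below)
          moreover have "j < c * m" using x by (simp add: j_def)
          ultimately show ?thesis
            using m(4)[of j] False old eqs by (simp add: W_def)
        qed
      qed
      then show False
        using free \<open>0 < m\<close> unfolding free_iff by blast
    qed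
    with n below have "less_fun w w'"
      unfolding less_fun_def by (metis linorder_neqE_nat)
    then show ?thesis ..
  qed simp
  ultimately have "lex_least_frac_power_free a b w"
    unfolding lex_least_frac_power_free_def by blast
  with ex1_lex_least_frac_power_free[OF \<open>0 < b\<close> \<open>b < a\<close>] have least: "least_word a b = w"
    unfolding least_word_def by (intro the1_equality)
  have "regular_sequence k (\<lambda>i. int (w i))"
  proof (rule regular_sequence_of_recurrence)
    show "0 < k" by (rule k_pos)
    show "\<exists>d. \<forall>i. int (w (k * i + j)) = d" if "j < k - 1" for j
    proof -
      have "j < k" using that by simp
      then have "w (k * i + j) = w (k * 0 + j)" for i
        unfolding w_rec[OF \<open>j < k\<close>] using that by simp
      then show ?thesis
        by metis
    qed
    show "int (w (k * i + (k - 1))) = int (w i) + 1" for i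
    proof -
      have "k * i + (k - 1) = k * Suc i - 1"
        using k_pos by simp
      then show ?thesis
        using W_mult[of "Suc i"] by (simp add: W_def)
    qed
  qed
  then show ?thesis
    using least k \<open>2 \<le> c\<close> by (simp add: rho_def w_def k_def)
qed

end
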